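(* Let $\lambda_1,\lambda_2,u,v\in\mathbb{Z}$ with $\gcd(u,v)=1$ and $v\mid(\lambda_1-\lambda_2)$, let $\Lambda=\operatorname{diag}(\lambda_1,\lambda_2)$, $M=\begin{pmatrix}1&u\\0&v\end{pmatrix}$, and assume $A=M\Lambda M^{-1}\in\operatorname{M}_2(\mathbb{Z})$ is non-singular with $\mathcal{P}'\ne\emptyset$. Assume $\operatorname{rad}(\lambda_2)$ divides $\operatorname{rad}(\lambda_1)$. Then $T\in\operatorname{End}(G_A)$ if and only if $$T=\begin{pmatrix}x&y\\0&z\end{pmatrix}\in\operatorname{M}_2(\mathcal{R}),\quad z\in\mathbb{Z}[\lambda_2^{-1}].$$ In particular, $\operatorname{End}(G_A)$ is not commutative and does not lie inside the centralizer of $A$ in $\operatorname{M}_2(\mathcal{R})$.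
   Context: $G_A=\{A^k\mathbf{x}\mid\mathbf{x}\in\mathbb{Z}^2,k\in\mathbb{Z}\}\subseteq\mathbb{Q}^2$; $\operatorname{End}(G_A)$ is identified with the set of $T\in\operatorname{M}_2(\mathbb{Q})$ with $T(G_A)\subseteq G_A$. $\mathcal{R}=\mathbb{Z}[1/\det A]$. $\mathcal{P}$ is the set of primes dividing $\det A$, $\mathcal{P}'=\{p\in\mathcal{P}\mid h_A\not\equiv x^2\pmod p\}$ with $h_A$ the characteristic polynomial of $A$. $\operatorname{rad}(m)$ is the product of the distinct primes dividing $m$. $\mathbb{Z}[\lambda^{-1}]\subseteq\mathbb{Q}$ is the ring generated by $1/\lambda$. *)

theory Defs
  imports
    "HOL-Number_Theory.Cong"
    "Jordan_Normal_Form.Char_Poly"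
    "Jordan_Normal_Form.Gauss_Jordan_Elimination"
begin

definition mat2 :: "'a \<Rightarrow> 'a \<Rightarrow> 'a \<Rightarrow> 'a \<Rightarrow> 'a mat" where
  "mat2 a b c d = mat_of_rows_list 2 [[a, b], [c, d]]"

(* Meaningful only for invertible matrices. *)
definition inv_mat :: "'a::field mat \<Rightarrow> 'a mat" where
  "inv_mat B = the (mat_inverse B)"

definition powi_mat :: "'a::field mat \<Rightarrow> int \<Rightarrow> 'a mat" where
  "powi_mat B k = (if 0 \<le> k then B ^\<^sub>m nat k else inv_mat B ^\<^sub>m nat (- k))"

abbreviation rat_mat :: "int mat \<Rightarrow> rat mat" where
  "rat_mat \<equiv> map_mat rat_of_int"

definition G :: "int mat \<Rightarrow> rat vec set" where
  "G A = {powi_mat (rat_mat A) k *\<^sub>v map_vec rat_of_int x | x k. x \<in> carrier_vec 2}"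

definition End_G :: "int mat \<Rightarrow> rat mat set" where
  "End_G A = {T \<in> carrier_mat 2 2. \<forall>g \<in> G A. T *\<^sub>v g \<in> G A}"

(* The smallest subring of the rationals containing r. *)
definition Z_adjoin :: "rat \<Rightarrow> rat set" where
  "Z_adjoin r = \<Inter> {S. 1 \<in> S \<and> r \<in> S \<and> (\<forall>a\<in>S. \<forall>b\<in>S. a - b \<in> S \<and> a * b \<in> S)}"

definition \<R> :: "int mat \<Rightarrow> rat set" where
  "\<R> A = Z_adjoin (1 / rat_of_int (det A))"

definition M2 :: "'a set \<Rightarrow> 'a mat set" where
  "M2 S = {T \<in> carrier_mat 2 2. elements_mat T \<subseteq> S}"

definition centralizer_M2 :: "int mat \<Rightarrow> rat set \<Rightarrow> rat mat set" where
  "centralizer_M2 A S = {T \<in> M2 S. T * rat_mat A = rat_mat A * T}"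

definition \<P> :: "int mat \<Rightarrow> int set" where
  "\<P> A = {p. prime p \<and> p dvd det A}"

(* Congruence of polynomials modulo p is coefficientwise. *)
definition \<P>' :: "int mat \<Rightarrow> int set" where
  "\<P>' A = {p \<in> \<P> A. \<not> (\<forall>i. [coeff (char_poly A) i = coeff (monom 1 2) i] (mod p))}"

(* Meaningful only for nonzero m: prime_factors 0 is empty. *)
definition rad :: "int \<Rightarrow> int" where
  "rad m = \<Prod> (prime_factors m)"

end

theory Submission
  imports Defs
begin

text \<open>
  The matrix \<open>A\<close> is upper triangular with diagonal \<open>\<lambda>\<^sub>1, \<lambda>\<^sub>2\<close>. The radical hypothesis says that
  \<open>\<lambda>\<^sub>2\<close> divides a power of \<open>\<lambda>\<^sub>1\<close>, so \<open>\<int>[1/\<lambda>\<^sub>2] \<subseteq> \<int>[1/\<lambda>\<^sub>1] = \<int>[1/det A]\<close>, and then \<open>G A\<close> splits as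
  \<open>\<int>[1/\<lambda>\<^sub>1] \<times> \<int>[1/\<lambda>\<^sub>2]\<close>: a sufficiently high power of \<open>A\<close> first makes the second coordinate integral
  and a further power makes the first coordinate integral. A prime in \<open>\<P>' A\<close> divides \<open>\<lambda>\<^sub>1\<close> but
  not \<open>\<lambda>\<^sub>2\<close>, so \<open>\<int>[1/\<lambda>\<^sub>2]\<close> contains no nonzero element that is divisible by all powers of \<open>\<lambda>\<^sub>1\<close>. This
  forces the lower left entry of an endomorphism to vanish.
\<close>

section \<open>Two-dimensional matrices and vectors\<close>

definition vec2 :: "'a \<Rightarrow> 'a \<Rightarrow> 'a vec" where
  "vec2 a b = vec_of_list [a, b]"

lemma vec2_carrier [simp]: "vec2 a b \<in> carrier_vec 2"
  by (simp add: vec2_def carrier_dim_vec)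

lemma dim_vec2 [simp]: "dim_vec (vec2 a b) = 2"
  by (simp add: vec2_def)

lemma vec2_index [simp]: "vec2 a b $ 0 = a" "vec2 a b $ Suc 0 = b"
  by (simp_all add: vec2_def vec_of_list_index)

lemma vec2_eq_iff [simp]: "vec2 a b = vec2 c d \<longleftrightarrow> a = c \<and> b = d"
  by (metis vec2_index)

lemma vec2_exhaust:
  assumes "g \<in> carrier_vec 2"
  obtains a b where "g = vec2 a b"
proof
  show "g = vec2 (g $ 0) (g $ 1)"
    using assms by (intro eq_vecI) (auto simp: less_2_cases_iff)
qed

lemma map_vec2 [simp]: "map_vec f (vec2 a b) = vec2 (f a) (f b)"
  by (intro eq_vecI) (auto simp: less_2_cases_iff)

lemma mat2_carrier [simp]: "mat2 a b c d \<in> carrier_mat 2 2"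
  by (rule carrier_matI) (simp_all add: mat2_def mat_of_rows_list_def)

lemma mat2_dim [simp]: "dim_row (mat2 a b c d) = 2" "dim_col (mat2 a b c d) = 2"
  by (simp_all add: mat2_def mat_of_rows_list_def)

lemma mat2_index [simp]:
  "mat2 a b c d $$ (0, 0) = a" "mat2 a b c d $$ (0, Suc 0) = b"
  "mat2 a b c d $$ (Suc 0, 0) = c" "mat2 a b c d $$ (Suc 0, Suc 0) = d"
  by (simp_all add: mat2_def mat_of_rows_list_def)

lemma mat2_eq_iff [simp]:
  "mat2 a b c d = mat2 a' b' c' d' \<longleftrightarrow> a = a' \<and> b = b' \<and> c = c' \<and> d = d'"
  by (metis mat2_index)

lemma mat2_exhaust:
  assumes "B \<in> carrier_mat 2 2"
  obtains a b c d where "B = mat2 a b c d"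
proof
  show "B = mat2 (B $$ (0, 0)) (B $$ (0, 1)) (B $$ (1, 0)) (B $$ (1, 1))"
    using assms by (intro eq_matI) (auto simp: less_2_cases_iff)
qed

lemma map_mat2 [simp]: "map_mat f (mat2 a b c d) = mat2 (f a) (f b) (f c) (f d)"
  by (intro eq_matI) (auto simp: less_2_cases_iff)

lemma sum_atLeast0LessThan_2: "(\<Sum>i = 0..<2. f i) = f 0 + f (Suc 0)"
  by (simp add: numeral_2_eq_2)

lemma mat2_mult [simp]:
  fixes a :: "'a::comm_semiring_1"
  shows "mat2 a b c d * mat2 a' b' c' d' =
    mat2 (a * a' + b * c') (a * b' + b * d') (c * a' + d * c') (c * b' + d * d')"
  by (intro eq_matI) (auto simp: less_2_cases_iff scalar_prod_def sum_atLeast0LessThan_2)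

lemma mat2_mult_vec2 [simp]:
  fixes a :: "'a::comm_semiring_1"
  shows "mat2 a b c d *\<^sub>v vec2 x y = vec2 (a * x + b * y) (c * x + d * y)"
  by (intro eq_vecI) (auto simp: less_2_cases_iff scalar_prod_def sum_atLeast0LessThan_2)

lemma one_mat2: "1\<^sub>m 2 = mat2 1 0 0 1"
  by (intro eq_matI) (auto simp: less_2_cases_iff)

lemma det_upper_mat2 [simp]:
  fixes a :: "'a::comm_ring_1"
  shows "det (mat2 a b 0 d) = a * d"
proof -
  have "det (mat2 a b 0 d) = prod_list (diag_mat (mat2 a b 0 d))"
    by (rule det_upper_triangular[OF _ mat2_carrier])
      (auto simp: upper_triangular_def less_2_cases_iff)
  then show ?thesis by (simp add: diag_mat_def numeral_2_eq_2)
qed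

lemma elements_mat2 [simp]: "elements_mat (mat2 a b c d) = {a, b, c, d}"
proof -
  have "{0..<2} = {0, Suc 0}" by auto
  then show ?thesis by (auto simp: elements_mat_def)
qed

lemma mat2_in_M2 [simp]: "mat2 a b c d \<in> M2 S \<longleftrightarrow> a \<in> S \<and> b \<in> S \<and> c \<in> S \<and> d \<in> S"
  by (simp add: M2_def)

text \<open>Only the diagonal is given in closed form; the corner entry enters later as some integer
  governed by the product rule for powers.\<close>

lemma upper_mat2_power:
  fixes a b d :: int
  shows "\<exists>s. mat2 a b 0 d ^\<^sub>m n = mat2 (a ^ n) s 0 (d ^ n)"
  by (induction n) (auto simp: one_mat2 mult.commute)

section \<open>Inverses and powers of square matrices\<close>

lemma inv_mat_props:
  fixes B :: "'a::field mat"
  assumes B: "B \<in> carrier_mat n n" and "det B \<noteq> 0"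
  shows "inv_mat B \<in> carrier_mat n n" "B * inv_mat B = 1\<^sub>m n" "inv_mat B * B = 1\<^sub>m n"
proof -
  have "mat_inverse B \<noteq> None"
    using mat_inverse(1)[OF B] det_non_zero_imp_unit[OF B \<open>det B \<noteq> 0\<close>]
    by metis
  then have "mat_inverse B = Some (inv_mat B)"
    by (auto simp: inv_mat_def)
  from mat_inverse(2)[OF B this]
  show "inv_mat B \<in> carrier_mat n n" "B * inv_mat B = 1\<^sub>m n" "inv_mat B * B = 1\<^sub>m n"
    by auto
qed

lemma invertible_mat_imp_det_nonzero:
  fixes B :: "'a::field mat"
  assumes B: "B \<in> carrier_mat n n" and "invertible_mat B"
  shows "det B \<noteq> 0"
proof -
  obtain C where BC: "B * C = 1\<^sub>m n" and CB: "C * B = 1\<^sub>m (dim_row C)"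
    using assms by (auto simp: invertible_mat_def inverts_mat_def)
  \<comment> \<open>\<open>invertible_mat\<close> does not fix the shape of the inverse, so it is
    read off from the two products.\<close>
  have "dim_col C = n" using arg_cong[OF BC, of dim_col] by simp
  moreover have "dim_row C = n" using arg_cong[OF CB, of dim_col] B by simp
  ultimately have "C \<in> carrier_mat n n" by auto
  then have "det B * det C = 1" using det_mult[OF B] BC by (metis det_one)
  then show ?thesis by auto
qed

lemma pow_mat_add:
  assumes A: "A \<in> carrier_mat n n"
  shows "A ^\<^sub>m (k + l) = A ^\<^sub>m k * A ^\<^sub>m l"
proof (induction l)
  case 0
  then show ?case using A by simp
next
  case (Suc l)
  then show ?case using A by (simp add: assoc_mult_mat[of _ n n _ n _ n])
qed

lemma inverse_pow_mat:
  fixes B C :: "'a::comm_ring_1 mat"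
  assumes "B \<in> carrier_mat n n" "C \<in> carrier_mat n n" "B * C = 1\<^sub>m n"
  shows "B ^\<^sub>m k * C ^\<^sub>m k = 1\<^sub>m n"
proof (induction k)
  case 0
  then show ?case using assms by simp
next
  case (Suc k)
  \<comment> \<open>Moving the extra factor of \<open>C\<close> to the left puts
    \<open>B * C\<close> in the middle, where it cancels.\<close>
  have comm: "C ^\<^sub>m k * C = C * C ^\<^sub>m k"
    using pow_mat_add[OF assms(2), of 1 k] pow_mat_add[OF assms(2), of k 1] assms(2) by simp
  have "B ^\<^sub>m Suc k * C ^\<^sub>m Suc k = (B ^\<^sub>m k * B) * (C * C ^\<^sub>m k)"
    using comm by simp
  also have "\<dots> = B ^\<^sub>m k * (B * C * C ^\<^sub>m k)"
    using assms(1,2) by (simp add: assoc_mult_mat[of _ n n _ n _ n])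
  finally show ?case using Suc assms by simp
qed

section \<open>Rings generated by the inverse of an integer\<close>

lemma Z_adjoin_closed:
  shows Z_adjoin_1: "1 \<in> Z_adjoin r"
    and Z_adjoin_gen: "r \<in> Z_adjoin r"
    and Z_adjoin_diff: "a \<in> Z_adjoin r \<Longrightarrow> b \<in> Z_adjoin r \<Longrightarrow> a - b \<in> Z_adjoin r"
    and Z_adjoin_mult: "a \<in> Z_adjoin r \<Longrightarrow> b \<in> Z_adjoin r \<Longrightarrow> a * b \<in> Z_adjoin r"
  by (auto simp: Z_adjoin_def)

lemma Z_adjoin_0: "0 \<in> Z_adjoin r"
  using Z_adjoin_diff[OF Z_adjoin_1 Z_adjoin_1] by simp

lemma Z_adjoin_add: "a \<in> Z_adjoin r \<Longrightarrow> b \<in> Z_adjoin r \<Longrightarrow> a + b \<in> Z_adjoin r"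
  using Z_adjoin_diff[of a r "0 - b"] Z_adjoin_diff[OF Z_adjoin_0, of b r] by simp

lemma Z_adjoin_of_int: "of_int m \<in> Z_adjoin r"
proof -
  have nat: "of_nat n \<in> Z_adjoin r" for n
    by (induction n) (auto intro: Z_adjoin_add Z_adjoin_0 Z_adjoin_1)
  obtain i j where "m = int i - int j" by (rule int_diff_cases)
  then show ?thesis using nat by (auto intro: Z_adjoin_diff)
qed

lemma Z_adjoin_power: "a \<in> Z_adjoin r \<Longrightarrow> a ^ n \<in> Z_adjoin r"
  by (induction n) (auto intro: Z_adjoin_mult Z_adjoin_1)

lemma Z_adjoin_subset: "r \<in> Z_adjoin s \<Longrightarrow> Z_adjoin r \<subseteq> Z_adjoin s"
  by (unfold Z_adjoin_def[of r]) (auto intro: Z_adjoin_closed)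

text \<open>The fractions whose denominator is cleared by some power of \<open>q\<close> form a
  subring containing \<open>1 / q\<close>, so the smallest such subring lies inside them.
  Conversely, such a fraction is an integer times a power of \<open>1 / q\<close>.\<close>

lemma Z_adjoin_inverse_iff:
  fixes q :: int
  assumes "q \<noteq> 0"
  shows "a \<in> Z_adjoin (1 / of_int q) \<longleftrightarrow> (\<exists>m n. of_int q ^ n * a = of_int m)"
proof
  define S :: "rat set" where "S = {a. \<exists>m n. of_int q ^ n * a = of_int m}"
  assume a: "a \<in> Z_adjoin (1 / of_int q)"
  have "b - c \<in> S \<and> b * c \<in> S" if bc: "b \<in> S" "c \<in> S" for b c
  proof -
    obtain m n where 1: "of_int q ^ n * b = of_int m"
      using bc by (auto simp: S_def)
    obtain m' n' where 2: "of_int q ^ n' * c = of_int m'"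
      using bc by (auto simp: S_def)
    have "of_int q ^ (n + n') * (b - c) =
        of_int q ^ n' * (of_int q ^ n * b) - of_int q ^ n * (of_int q ^ n' * c)"
      by (simp add: power_add algebra_simps)
    also have "\<dots> = of_int (q ^ n' * m - q ^ n * m')"
      unfolding 1 2 by simp
    finally have "b - c \<in> S" unfolding S_def by blast
    moreover have "of_int q ^ (n + n') * (b * c) = (of_int q ^ n * b) * (of_int q ^ n' * c)"
      by (simp add: power_add algebra_simps)
    then have "of_int q ^ (n + n') * (b * c) = of_int (m * m')"
      unfolding 1 2 by simp
    then have "b * c \<in> S" unfolding S_def by blast
    ultimately show ?thesis ..
  qed
  moreover have "of_int q ^ 0 * 1 = (of_int 1 :: rat)"
    by simp
  then have "1 \<in> S"
    unfolding S_def by blast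
  moreover have "of_int q ^ 1 * (1 / of_int q) = (of_int 1 :: rat)"
    using assms by simp
  then have "1 / of_int q \<in> S"
    unfolding S_def by blast
  ultimately have "a \<in> S"
    using a unfolding Z_adjoin_def by blast
  then show "\<exists>m n. of_int q ^ n * a = of_int m"
    by (simp add: S_def)
next
  assume "\<exists>m n. of_int q ^ n * a = of_int m"
  then obtain m n where "of_int q ^ n * a = of_int m" by blast
  then have "a = of_int m * (1 / of_int q) ^ n"
    using assms by (simp add: field_simps)
  then show "a \<in> Z_adjoin (1 / of_int q)"
    by (simp only: Z_adjoin_mult Z_adjoin_of_int Z_adjoin_power Z_adjoin_gen)
qed

text \<open>If \<open>a ^ n = b * k\<close>, then \<open>1 / b = k / a ^ n\<close>, so the generator
  of one ring lies in the other.\<close>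

lemma Z_adjoin_inverse_subset:
  fixes a b :: int
  assumes "b \<noteq> 0" "a \<noteq> 0" "b dvd a ^ n"
  shows "Z_adjoin (1 / of_int b) \<subseteq> Z_adjoin (1 / of_int a)"
proof (rule Z_adjoin_subset)
  obtain k where "a ^ n = b * k" using assms(3) by blast
  then have "of_int a ^ n = (of_int b * of_int k :: rat)"
    by (metis of_int_mult of_int_power)
  then have "of_int a ^ n * (1 / of_int b) = (of_int k :: rat)"
    using assms by simp
  then show "1 / rat_of_int b \<in> Z_adjoin (1 / rat_of_int a)"
    using Z_adjoin_inverse_iff[OF assms(2)] by blast
qed

text \<open>Clearing the denominator of \<open>w\<close> by a power of \<open>b\<close> leaves an
  integer \<open>m\<close>. Powers of \<open>b\<close> are coprime to \<open>p\<close>, so dividing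
  \<open>w\<close> by ever higher powers of \<open>a\<close> makes every power of \<open>p\<close>
  divide \<open>m\<close>, which only zero allows.\<close>

lemma Z_adjoin_divisible_eq_0:
  fixes a b p :: int
  assumes "b \<noteq> 0" "a \<noteq> 0" "prime p" "p dvd a" "\<not> p dvd b"
    and div: "\<And>n. w / of_int a ^ n \<in> Z_adjoin (1 / of_int b)"
  shows "w = 0"
proof -
  \<comment> \<open>Exponent 0 gives \<open>w\<close> itself. This \<open>m\<close> is fixed once,
    whereas \<open>m'\<close> and \<open>k'\<close> below vary with \<open>n\<close>.\<close>
  obtain m k where mk: "of_int b ^ k * w = of_int m"
    using div[of 0] Z_adjoin_inverse_iff[OF assms(1)] by auto
  have "p ^ n dvd m" for n
  proof -
    obtain m' k' where "of_int b ^ k' * (w / of_int a ^ n) = of_int m'"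
      using div[of n] Z_adjoin_inverse_iff[OF assms(1)] by auto
    then have w: "of_int b ^ k' * w = of_int m' * of_int a ^ n"
      using assms by (simp add: field_simps)
    have "of_int (b ^ k' * m) = of_int b ^ k * (of_int b ^ k' * w)"
      using mk by (simp add: algebra_simps)
    also have "\<dots> = of_int (b ^ k * m' * a ^ n)"
      unfolding w by simp
    finally have "b ^ k' * m = b ^ k * m' * a ^ n"
      by (simp only: of_int_eq_iff)
    then have "p ^ n dvd b ^ k' * m"
      using \<open>p dvd a\<close> by (simp add: dvd_power_same)
    moreover have "coprime (p ^ n) (b ^ k')"
      using assms by (simp add: prime_imp_coprime)
    ultimately show ?thesis
      by (simp add: coprime_dvd_mult_right_iff)
  qed
  moreover have "\<not> is_unit p" using \<open>prime p\<close> by auto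
  ultimately have "m = 0"
    using finite_divisor_powers[of m p] by auto
  then show ?thesis using mk assms by simp
qed

section \<open>Radicals and divisibility of powers\<close>

lemma rad_dvd_imp_prime_dvd:
  assumes "a \<noteq> 0" "rad a dvd rad b" "prime p" "p dvd a"
  shows "p dvd b"
proof -
  have "p \<in> prime_factors a"
    using assms by (simp add: in_prime_factors_iff)
  then have "p dvd rad a"
    unfolding rad_def by (intro dvd_prodI[where f = "\<lambda>x. x", simplified]) auto
  then have "p dvd \<Prod>(prime_factors b)"
    using assms by (auto simp: rad_def intro: dvd_trans)
  then obtain q where "q \<in> prime_factors b" "p dvd q"
    using \<open>prime p\<close> prime_dvd_prod_iff[of "prime_factors b" p "\<lambda>x. x"] by auto
  then show ?thesis
    by (meson dvd_trans in_prime_factors_imp_dvd)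
qed

text \<open>Every prime factor of \<open>a\<close> divides \<open>b\<close>, so the exponent can be
  the number of prime factors of \<open>a\<close> counted with multiplicity.\<close>

lemma rad_dvd_imp_dvd_power:
  assumes "a \<noteq> 0" "rad a dvd rad b"
  shows "\<exists>n. a dvd b ^ n"
proof -
  have "prod_mset N dvd b ^ size N" if "\<forall>p\<in>#N. p dvd b" for N
    using that by (induction N) (auto intro: mult_dvd_mono)
  moreover have "\<forall>p\<in>#prime_factorization a. p dvd b"
    using assms rad_dvd_imp_prime_dvd by auto
  ultimately have "prod_mset (prime_factorization a) dvd b ^ size (prime_factorization a)"
    by blast
  \<comment> \<open>The product of the prime factorization is \<open>a\<close> only up to sign,
    which divisibility ignores.\<close>
  then show ?thesis
    using \<open>a \<noteq> 0\<close> by (auto simp: prod_mset_prime_factorization)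
qed

section \<open>The group and its endomorphisms for an upper triangular matrix\<close>

text \<open>Replaces integer powers of the rational matrix by natural powers of \<open>A\<close>: a
  negative power of \<open>A\<close> applied to an integral vector is undone by the opposite power,
  and a nonnegative one already yields an integral vector.\<close>

lemma G_iff:
  assumes A: "A \<in> carrier_mat 2 2" and "det A \<noteq> 0" and g: "g \<in> carrier_vec 2"
  shows "g \<in> G A \<longleftrightarrow>
    (\<exists>n. \<exists>x\<in>carrier_vec 2. rat_mat (A ^\<^sub>m n) *\<^sub>v g = map_vec rat_of_int x)"
proof -
  define B where "B = rat_mat A"
  define C where "C = inv_mat B"
  have B: "B \<in> carrier_mat 2 2" using A by (simp add: B_def)
  have "det B \<noteq> 0"
    using \<open>det A \<noteq> 0\<close> by (simp add: B_def of_int_hom.hom_det)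
  note C = inv_mat_props[OF B this, folded C_def]
  have pow: "rat_mat (A ^\<^sub>m n) = B ^\<^sub>m n" for n
    using A by (simp add: B_def of_int_hom.mat_hom_pow)
  have BC: "B ^\<^sub>m n *\<^sub>v (C ^\<^sub>m n *\<^sub>v h) = h" "C ^\<^sub>m n *\<^sub>v (B ^\<^sub>m n *\<^sub>v h) = h"
    if "h \<in> carrier_vec 2" for n h
    using that B C inverse_pow_mat[OF B C(1,2), of n] inverse_pow_mat[OF C(1) B C(3), of n]
    by (simp_all flip: assoc_mult_mat_vec[of _ 2 2 _ 2])
  show ?thesis unfolding pow
  proof
    assume "g \<in> G A"
    then obtain k x where gk: "g = powi_mat B k *\<^sub>v map_vec rat_of_int x"
      and x: "x \<in> carrier_vec 2"
      by (auto simp: G_def B_def)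
    show "\<exists>n. \<exists>x\<in>carrier_vec 2. B ^\<^sub>m n *\<^sub>v g = map_vec rat_of_int x"
    proof (cases "0 \<le> k")
      case True
      \<comment> \<open>Here the witness is \<open>n = 0\<close>, since \<open>g\<close> itself is
        integral.\<close>
      have "B ^\<^sub>m 0 *\<^sub>v g = rat_mat (A ^\<^sub>m nat k) *\<^sub>v map_vec rat_of_int x"
        using True gk g B by (simp add: powi_mat_def pow)
      also have "\<dots> = map_vec rat_of_int (A ^\<^sub>m nat k *\<^sub>v x)"
        using A x by (simp add: of_int_hom.mult_mat_vec_hom[of _ 2 2])
      finally show ?thesis
        using A x by (metis mult_mat_vec_carrier pow_carrier_mat)
    next
      case False
      then have "B ^\<^sub>m nat (- k) *\<^sub>v g = map_vec rat_of_int x"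
        using gk x BC(1) by (simp add: powi_mat_def C_def)
      then show ?thesis using x by blast
    qed
  next
    assume "\<exists>n. \<exists>x\<in>carrier_vec 2. B ^\<^sub>m n *\<^sub>v g = map_vec rat_of_int x"
    then obtain n x where x: "x \<in> carrier_vec 2" "B ^\<^sub>m n *\<^sub>v g = map_vec rat_of_int x"
      by blast
    then have "g = C ^\<^sub>m n *\<^sub>v map_vec rat_of_int x"
      using BC(2)[OF g, of n] by simp
    \<comment> \<open>For \<open>n = 0\<close> the exponent falls into the nonnegative branch of
      \<open>powi_mat\<close>; both sides are then the identity.\<close>
    also have "C ^\<^sub>m n = powi_mat B (- int n)"
      using B C(1) by (cases "n = 0") (auto simp: powi_mat_def C_def)
    finally show "g \<in> G A" using x(1) by (auto simp: G_def B_def)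
  qed
qed

lemma G_carrier: "A \<in> carrier_mat 2 2 \<Longrightarrow> det A \<noteq> 0 \<Longrightarrow> G A \<subseteq> carrier_vec 2"
proof
  fix g assume A: "A \<in> carrier_mat 2 2" "det A \<noteq> 0" and "g \<in> G A"
  then obtain k x where g: "g = powi_mat (rat_mat A) k *\<^sub>v map_vec rat_of_int x"
    and x: "x \<in> carrier_vec 2"
    by (auto simp: G_def)
  have "inv_mat (rat_mat A) \<in> carrier_mat 2 2"
    using A by (intro inv_mat_props) (auto simp: of_int_hom.hom_det)
  then have "powi_mat (rat_mat A) k \<in> carrier_mat 2 2"
    using A by (simp add: powi_mat_def)
  then show "g \<in> carrier_vec 2" using g x by simp
qed

text \<open>The corner entry of a power of the matrix only adds an integer multiple of the second
  coordinate to the first. By \<open>sub\<close> that multiple stays in the ring of the first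
  coordinate, so \<open>c\<close> has no influence on the group.\<close>

lemma vec2_in_G_upper_iff:
  fixes a b c :: int
  assumes "a \<noteq> 0" "b \<noteq> 0" and sub: "Z_adjoin (1 / of_int b) \<subseteq> Z_adjoin (1 / of_int a)"
  shows "vec2 r s \<in> G (mat2 a c 0 b) \<longleftrightarrow>
    r \<in> Z_adjoin (1 / of_int a) \<and> s \<in> Z_adjoin (1 / of_int b)"
proof -
  obtain t where t: "\<And>n. mat2 a c 0 b ^\<^sub>m n = mat2 (a ^ n) (t n) 0 (b ^ n)"
    using upper_mat2_power by metis
  have "vec2 r s \<in> G (mat2 a c 0 b) \<longleftrightarrow> (\<exists>n. \<exists>x\<in>carrier_vec 2.
      rat_mat (mat2 a c 0 b ^\<^sub>m n) *\<^sub>v vec2 r s = map_vec rat_of_int x)"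
    using assms by (intro G_iff) auto
  also have "\<dots> \<longleftrightarrow> (\<exists>n i j. of_int a ^ n * r + of_int (t n) * s = of_int i \<and>
      of_int b ^ n * s = of_int j)" (is "_ \<longleftrightarrow> ?int")
  proof -
    have "(\<exists>x\<in>carrier_vec 2. P x) \<longleftrightarrow> (\<exists>i j. P (vec2 i j))" for P :: "int vec \<Rightarrow> bool"
      by (metis vec2_carrier vec2_exhaust)
    then show ?thesis unfolding t by simp
  qed
  also have "\<dots> \<longleftrightarrow> r \<in> Z_adjoin (1 / of_int a) \<and> s \<in> Z_adjoin (1 / of_int b)"
  proof
    assume ?int
    then obtain n i j where r: "of_int a ^ n * r + of_int (t n) * s = of_int i"
      and s: "of_int b ^ n * s = of_int j" by blast
    have sb: "s \<in> Z_adjoin (1 / of_int b)"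
      using s Z_adjoin_inverse_iff[OF assms(2)] by blast
    have "r = (of_int i - of_int (t n) * s) * (1 / of_int a) ^ n"
      using r assms(1) by (simp add: field_simps)
    moreover have "(of_int i - of_int (t n) * s) * (1 / of_int a) ^ n \<in> Z_adjoin (1 / of_int a)"
      using sb sub
      by (intro Z_adjoin_mult Z_adjoin_diff Z_adjoin_of_int Z_adjoin_power Z_adjoin_gen) auto
    ultimately show "r \<in> Z_adjoin (1 / of_int a) \<and> s \<in> Z_adjoin (1 / of_int b)"
      using sb by simp
  next
    assume rs: "r \<in> Z_adjoin (1 / of_int a) \<and> s \<in> Z_adjoin (1 / of_int b)"
    obtain n j where s: "of_int b ^ n * s = of_int j"
      using rs Z_adjoin_inverse_iff[OF assms(2)] by blast
    \<comment> \<open>The first coordinate after \<open>n\<close> applications of the matrix, when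
      the second is already the integer \<open>j\<close>.\<close>
    define r' where "r' = of_int a ^ n * r + of_int (t n) * s"
    have "of_int (a ^ n) * r + of_int (t n) * s \<in> Z_adjoin (1 / of_int a)"
      using rs sub by (intro Z_adjoin_add Z_adjoin_mult Z_adjoin_of_int) auto
    then have "r' \<in> Z_adjoin (1 / of_int a)" by (simp add: r'_def)
    then obtain n' i where r': "of_int a ^ n' * r' = of_int i"
      using Z_adjoin_inverse_iff[OF assms(1)] by blast
    \<comment> \<open>Comparing corner entries in this product gives the addition rule
      \<open>tt\<close>; the \<open>n'\<close> further applications then make \<open>r'\<close>
      integral and keep the second coordinate integral.\<close>
    have "mat2 a c 0 b ^\<^sub>m (n' + n) = mat2 a c 0 b ^\<^sub>m n' * mat2 a c 0 b ^\<^sub>m n"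
      by (rule pow_mat_add[of _ 2, OF mat2_carrier])
    then have tt: "t (n' + n) = a ^ n' * t n + t n' * b ^ n"
      unfolding t by simp
    have "of_int a ^ (n' + n) * r + of_int (t (n' + n)) * s
        = of_int a ^ n' * r' + of_int (t n') * (of_int b ^ n * s)"
      unfolding tt r'_def by (simp add: power_add algebra_simps)
    also have "\<dots> = of_int (i + t n' * j)"
      unfolding r' s by simp
    finally have 1: "of_int a ^ (n' + n) * r + of_int (t (n' + n)) * s = of_int (i + t n' * j)" .
    have "of_int b ^ (n' + n) * s = of_int b ^ n' * (of_int b ^ n * s)"
      by (simp add: power_add)
    also have "\<dots> = of_int (b ^ n' * j)"
      unfolding s by simp
    finally show ?int using 1 by blast
  qed
  finally show ?thesis .
qed

text \<open>Since the group is a product of two rings, being an endomorphism is a condition on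
  coordinates that can be tested on a few vectors.\<close>

lemma End_G_upper_iff:
  fixes a b c p :: int
  assumes "a \<noteq> 0" "b \<noteq> 0" and sub: "Z_adjoin (1 / of_int b) \<subseteq> Z_adjoin (1 / of_int a)"
    and p: "prime p" "p dvd a" "\<not> p dvd b"
  shows "mat2 x y w z \<in> End_G (mat2 a c 0 b) \<longleftrightarrow>
    w = 0 \<and> x \<in> Z_adjoin (1 / of_int a) \<and> y \<in> Z_adjoin (1 / of_int a) \<and>
    z \<in> Z_adjoin (1 / of_int b)"
proof -
  let ?Ra = "Z_adjoin (1 / rat_of_int a)" and ?Rb = "Z_adjoin (1 / rat_of_int b)"
  have "G (mat2 a c 0 b) \<subseteq> carrier_vec 2"
    using assms by (intro G_carrier) auto
  then have G: "G (mat2 a c 0 b) = {vec2 r s | r s. r \<in> ?Ra \<and> s \<in> ?Rb}"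
    using vec2_in_G_upper_iff[OF assms(1-3)] by (blast elim: vec2_exhaust)
  have "mat2 x y w z \<in> End_G (mat2 a c 0 b) \<longleftrightarrow>
      (\<forall>r\<in>?Ra. \<forall>s\<in>?Rb. x * r + y * s \<in> ?Ra \<and> w * r + z * s \<in> ?Rb)" (is "?L \<longleftrightarrow> ?map")
  proof
    assume ?L
    then have "mat2 x y w z *\<^sub>v vec2 r s \<in> G (mat2 a c 0 b)" if "r \<in> ?Ra" "s \<in> ?Rb" for r s
      using that unfolding End_G_def G by blast
    then show ?map unfolding G by simp
  qed (auto simp: End_G_def G)
  also have "\<dots> \<longleftrightarrow> w = 0 \<and> x \<in> ?Ra \<and> y \<in> ?Ra \<and> z \<in> ?Rb"
  proof
    assume map: ?map
    \<comment> \<open>This is the second coordinate of the image of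
      \<open>vec2 (1 / a ^ n) 0\<close>.\<close>
    have "w / of_int a ^ n \<in> ?Rb" for n
      using map[rule_format, OF Z_adjoin_power[OF Z_adjoin_gen] Z_adjoin_0, of n]
      by (simp add: power_one_over)
    then have "w = 0"
      using Z_adjoin_divisible_eq_0[OF assms(2,1) p] by blast
    \<comment> \<open>The images of the two standard basis vectors are the columns of the
      matrix.\<close>
    then show "w = 0 \<and> x \<in> ?Ra \<and> y \<in> ?Ra \<and> z \<in> ?Rb"
      using map[rule_format, of 1 0] map[rule_format, of 0 1]
      by (simp add: Z_adjoin_0 Z_adjoin_1)
  next
    assume "w = 0 \<and> x \<in> ?Ra \<and> y \<in> ?Ra \<and> z \<in> ?Rb"
    then show ?map
      using sub by (auto intro!: Z_adjoin_add Z_adjoin_mult)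
  qed
  finally show ?thesis .
qed

section \<open>Reading the hypotheses on \<open>A\<close>: characteristic polynomial, the primes in
  \<open>\<P>'\<close>, triangular form\<close>

lemma char_poly_upper_mat2:
  fixes a b c :: int
  shows "char_poly (mat2 a c 0 b) = [:- a, 1:] * [:- b, 1:]"
proof -
  have "char_poly_matrix (mat2 a c 0 b) = mat2 [:- a, 1:] [:- c:] 0 [:- b, 1:]"
    by (intro eq_matI) (auto simp: less_2_cases_iff char_poly_matrix_def)
  then show ?thesis by (simp add: char_poly_def)
qed

text \<open>The characteristic polynomial is monic quadratic with constant term
  \<open>a * b\<close>, which \<open>p\<close> divides. The congruence with the square can therefore
  fail only at the linear coefficient \<open>- (a + b)\<close>.\<close>

lemma \<P>'_upper_mat2:
  fixes a b c p :: int
  assumes "p \<in> \<P>' (mat2 a c 0 b)"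
  shows "prime p" "p dvd a * b" "\<not> p dvd a + b"
proof -
  show "prime p" "p dvd a * b"
    using assms by (auto simp: \<P>'_def \<P>_def)
  show "\<not> p dvd a + b"
  proof
    assume "p dvd a + b"
    have "[coeff (char_poly (mat2 a c 0 b)) i = coeff (monom 1 2) i] (mod p)" for i
    proof -
      consider "i = 0" | "i = 1" | "i = 2" | k where "i = Suc (Suc (Suc k))"
        by (metis One_nat_def Suc_1 not0_implies_Suc)
      then show ?thesis
      proof cases
        case 1
        then show ?thesis using \<open>p dvd a * b\<close>
          by (simp add: char_poly_upper_mat2 cong_0_iff mult.commute)
      next
        case 2
        have "- b - a = (a + b) * (- 1)" by simp
        then have "p dvd - b - a"
          using \<open>p dvd a + b\<close> by (metis dvd_mult2)
        with 2 show ?thesis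
          by (simp add: char_poly_upper_mat2 cong_0_iff)
      qed (simp_all add: char_poly_upper_mat2 numeral_2_eq_2)
    qed
    then show False using assms by (auto simp: \<P>'_def)
  qed
qed

text \<open>The columns of \<open>M\<close> are eigenvectors of \<open>A\<close>. The first is the
  first standard basis vector, which determines the first column of \<open>A\<close>; the second has
  nonzero last entry \<open>v\<close>, which forces the remaining diagonal entry to be
  \<open>lam2\<close>.\<close>

lemma upper_triangular_of_diagonalization:
  fixes lam1 lam2 u v :: int
  assumes "M = mat2 1 (rat_of_int u) 0 (rat_of_int v)" "invertible_mat M"
    and A: "A \<in> carrier_mat 2 2"
    and eq: "rat_mat A = M * mat2 (rat_of_int lam1) 0 0 (rat_of_int lam2) * inv_mat M"
  obtains c where "A = mat2 lam1 c 0 lam2"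
proof -
  have M: "M \<in> carrier_mat 2 2" using assms by simp
  have det: "det M \<noteq> 0"
    using M assms(2) by (rule invertible_mat_imp_det_nonzero)
  then have "v \<noteq> 0" using assms(1) by simp
  note inv = inv_mat_props[OF M det]
  have "rat_mat A * M = M * mat2 (rat_of_int lam1) 0 0 (rat_of_int lam2) * (inv_mat M * M)"
    unfolding eq using M inv(1) by (intro assoc_mult_mat[of _ 2 2 _ 2 _ 2]) auto
  also have "\<dots> = M * mat2 (rat_of_int lam1) 0 0 (rat_of_int lam2)"
    unfolding inv(3) using M by (intro right_mult_one_mat[of _ 2]) auto
  finally have AM: "rat_mat A * M = M * mat2 (rat_of_int lam1) 0 0 (rat_of_int lam2)" .
  obtain a b c d where "A = mat2 a b c d" using A by (rule mat2_exhaust)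
  with AM \<open>v \<noteq> 0\<close> have "A = mat2 lam1 b 0 lam2"
    unfolding assms(1) by (auto simp: mult.commute)
  then show thesis by (rule that)
qed

theorem theorem3p7:
  fixes lam1 lam2 u v :: int and A :: "int mat" and \<Lambda> M :: "rat mat"
  assumes "gcd u v = 1"
    and "v dvd (lam1 - lam2)"
    and "\<Lambda> = mat2 (rat_of_int lam1) 0 0 (rat_of_int lam2)"
    and "M = mat2 1 (rat_of_int u) 0 (rat_of_int v)"
    and "invertible_mat M"
    and "A \<in> carrier_mat 2 2"
    and "rat_mat A = M * \<Lambda> * inv_mat M"
    and "det A \<noteq> 0"
    and "\<P>' A \<noteq> {}"
    and "rad lam2 dvd rad lam1"
  shows "(\<forall>T. T \<in> End_G A \<longleftrightarrow>
            (\<exists>x y z. T = mat2 x y 0 z \<and> T \<in> M2 (\<R> A) \<and> z \<in> Z_adjoin (1 / rat_of_int lam2)))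
       \<and> \<not> (\<forall>S \<in> End_G A. \<forall>T \<in> End_G A. S * T = T * S)
       \<and> \<not> End_G A \<subseteq> centralizer_M2 A (\<R> A)"
proof -
  obtain c where A: "A = mat2 lam1 c 0 lam2"
    using upper_triangular_of_diagonalization[OF assms(4-6)] assms(3,7) by metis
  have nz: "lam1 \<noteq> 0" "lam2 \<noteq> 0" using assms(8) A by auto
  obtain p where "p \<in> \<P>' A" using assms(9) by blast
  note p' = \<P>'_upper_mat2[OF this[unfolded A]]
  \<comment> \<open>If \<open>p\<close> divided \<open>lam2\<close>, the radical hypothesis would
    make it divide \<open>lam1\<close> too, hence also the trace, contrary to
    \<open>p'\<close>.\<close>
  have p: "prime p" "p dvd lam1" "\<not> p dvd lam2"
    using p' rad_dvd_imp_prime_dvd[OF nz(2) assms(10), of p]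
    by (auto simp: prime_dvd_mult_iff)
  obtain n where n: "lam2 dvd lam1 ^ n"
    using rad_dvd_imp_dvd_power nz assms(10) by blast
  note sub = Z_adjoin_inverse_subset[OF nz(2,1) n]
  have "\<R> A = Z_adjoin (1 / rat_of_int (lam1 * lam2))"
    by (simp add: \<R>_def A)
  \<comment> \<open>Each of \<open>lam1 * lam2\<close> and \<open>lam1\<close> divides a power of
    the other, so their inverses generate the same ring.\<close>
  moreover have "lam1 * lam2 dvd lam1 ^ Suc n" "lam1 dvd (lam1 * lam2) ^ 1"
    using n by auto
  ultimately have R: "\<R> A = Z_adjoin (1 / rat_of_int lam1)"
    using nz by (metis Z_adjoin_inverse_subset mult_eq_0_iff subset_antisym)
  note End = End_G_upper_iff[OF nz sub p, of _ _ _ _ c, folded A]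
  have iff: "T \<in> End_G A \<longleftrightarrow>
      (\<exists>x y z. T = mat2 x y 0 z \<and> T \<in> M2 (\<R> A) \<and> z \<in> Z_adjoin (1 / rat_of_int lam2))" for T
  proof (cases "T \<in> carrier_mat 2 2")
    case True
    then obtain x y w z where "T = mat2 x y w z" by (rule mat2_exhaust)
    \<comment> \<open>The inclusion \<open>sub\<close> puts \<open>z\<close> into
      \<open>\<R> A\<close>, as membership in \<open>M2\<close> demands.\<close>
    then show ?thesis using sub by (auto simp: End R Z_adjoin_0)
  qed (auto simp: End_G_def)
  \<comment> \<open>Two matrix units: their product in one order is the second of them, in the other
    order it is zero.\<close>
  have "mat2 1 0 0 0 \<in> End_G A" and N: "mat2 0 1 0 0 \<in> End_G A"
    by (simp_all add: End Z_adjoin_0 Z_adjoin_1)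
  moreover have "mat2 1 0 0 0 * mat2 0 1 0 0 \<noteq> mat2 0 1 0 0 * mat2 1 0 0 (0 :: rat)"
    by simp
  ultimately have "\<not> (\<forall>S \<in> End_G A. \<forall>T \<in> End_G A. S * T = T * S)"
    by blast
  \<comment> \<open>Multiplying the nilpotent unit by \<open>A\<close> on the left leaves
    \<open>lam1\<close> in the corner, on the right \<open>lam2\<close>; these differ because
    \<open>p\<close> divides only the first.\<close>
  moreover have "lam1 \<noteq> lam2" using p by blast
  then have "mat2 0 1 0 0 \<notin> centralizer_M2 A (\<R> A)"
    by (simp add: centralizer_M2_def A)
  ultimately show ?thesis using N iff by blast
qed

end
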